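(* Let $p\ge2$. The set of dominant, indivisible, $\mathfrak{p}^-$-admissible one-parameter subgroups of $T_{\mathbb{C}}$ associated to $G=SO(2p,2)$ is $$\{\lambda_0,\lambda_1^+,\lambda_1^-,\lambda_{-1}^+,\lambda_{-1}^-\},$$ where $\lambda_0=(1,0,\dots,0;0)$, $\lambda_1^{\pm}=(1,\dots,1;\pm1)$ and $\lambda_{-1}^{\pm}=(1,\dots,1,-1;\pm1)$.
   Context: For $G=SO(2p,2)$ the maximal compact subgroup considered is $K=SO(2p)\times SO(2)$. Let $\mathfrak{t}$ be the Cartan subalgebra of block-diagonal matrices with $2\times2$ blocks $\begin{pmatrix}0&h_k\\-h_k&0\end{pmatrix}$, $k=1,\dots,p+1$, with canonical basis $(e_1,\dots,e_{p+1})$ and dual basis $(e_k^* )$ ($e_{p+1}$ spanning the Lie algebra of $SO(2)$); $T_{\mathbb{C}}$ is the corresponding maximal torus of $K_{\mathbb{C}}$, and one-parameter subgroups of $T_{\mathbb{C}}$ are identified with $\lambda=(\lambda_1,\dots,\lambda_p;\lambda_{p+1})\in\mathbb{Z}^{p+1}$ in the basis $(e_k)$. The positive compact roots are $e_i^*\pm e_j^*$, $1\le i<j\le p$, so that $\lambda$ is dominant iff $\lambda_1\ge\dots\ge\lambda_p$ and $\lambda_{p-1}+\lambda_p\ge0$. $\lambda$ is indivisible if it is not $n\lambda'$ with $n>1$ an integer and $\lambda'\in\mathbb{Z}^{p+1}$. $\mathfrak{p}^-$ is the $2p$-dimensional $K_{\mathbb{C}}$-module whose $T_{\mathbb{C}}$-weights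 are $-(\pm e_i^*+e_{p+1}^* )$, $i=1,\dots,p$ (negatives of the positive noncompact roots). $\lambda$ is $\mathfrak{p}^-$-admissible if there is $v\in\mathfrak{p}^-$ such that $\lambda(\mathbb{C}^* )$ is the identity component of the stabilizer of $v$ in $T_{\mathbb{C}}$; equivalently, the line $\mathbb{C}\lambda\subset\mathfrak{t}_{\mathbb{C}}$ is the intersection of the kernels of a family of weights of $\mathfrak{p}^-$. *)

theory Defs
  imports "HOL-Analysis.Function_Topology" "Jordan_Normal_Form.Matrix"
begin

text \<open>
  All matrices have size \<open>2p + 2\<close>. Matrix indices, and indices of \<open>e\<^sub>k\<close> and of the entries of
  \<open>\<lambda>\<close>, start at 0: the \<open>k\<close>-th block occupies the rows and columns \<open>2k\<close> and \<open>2k + 1\<close>,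
  \<open>k = 0, \<dots>, p - 1\<close> are the blocks of \<open>SO(2p)\<close>, and \<open>k = p\<close> is the block of \<open>SO(2)\<close>.
\<close>

definition block_diag :: "nat \<Rightarrow> (nat \<Rightarrow> complex) \<Rightarrow> (nat \<Rightarrow> complex) \<Rightarrow> complex mat" where
  "block_diag p a b = mat (2 * p + 2) (2 * p + 2) (\<lambda>(i, j).
     if i div 2 \<noteq> j div 2 then 0
     else if i = j then a (i div 2)
     else if even i then b (i div 2)
     else - b (i div 2))"

definition cartan_basis :: "nat \<Rightarrow> nat \<Rightarrow> complex mat" where
  "cartan_basis p k = block_diag p (\<lambda>_. 0) (\<lambda>l. if l = k then 1 else 0)"

text \<open>The maximal torus is \<open>SO(2, \<complex>)\<^sup>p \<times> SO(2, \<complex>)\<close>. The weight \<open>e\<^sub>k\<^sup>*\<close> is the character with value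
  \<open>a k + \<i> * b k\<close> on \<open>block_diag p a b\<close>; its differential on \<open>\<Sum>k. h\<^sub>k e\<^sub>k\<close> is \<open>\<i> h\<^sub>k\<close>, in accordance
  with the usual normalisation of real roots.\<close>

definition torus :: "nat \<Rightarrow> complex mat set" where
  "torus p = {block_diag p a b | a b. \<forall>k\<le>p. (a k)\<^sup>2 + (b k)\<^sup>2 = 1}"

text \<open>The one-parameter subgroup \<open>\<lambda>\<close> sends \<open>exp (\<i> \<theta>)\<close> to \<open>exp (\<theta> * (\<Sum>k. \<lambda>\<^sub>k e\<^sub>k))\<close>; the entries of its
  blocks are the cosine and sine of \<open>\<lambda>\<^sub>k \<theta>\<close> written in terms of \<open>z = exp (\<i> \<theta>)\<close>.\<close>

definition one_ps :: "nat \<Rightarrow> int vec \<Rightarrow> complex \<Rightarrow> complex mat" where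
  "one_ps p l z = block_diag p
     (\<lambda>k. (z powi (vec_index l k) + z powi (- vec_index l k)) / 2)
     (\<lambda>k. (z powi (vec_index l k) - z powi (- vec_index l k)) / (2 * \<i>))"

definition form_mat :: "nat \<Rightarrow> complex mat" where
  "form_mat p = mat (2 * p + 2) (2 * p + 2) (\<lambda>(i, j).
     if i \<noteq> j then 0 else if i < 2 * p then 1 else - 1)"

definition so_complex :: "nat \<Rightarrow> complex mat set" where
  "so_complex p = {X \<in> carrier_mat (2 * p + 2) (2 * p + 2).
     transpose_mat X * form_mat p + form_mat p * X = 0\<^sub>m (2 * p + 2) (2 * p + 2)}"

text \<open>The complexified Cartan decomposition of \<open>\<ss>\<oo>(2p, 2)\<close> is that of conjugation by
  \<open>form_mat p\<close>. The central element \<open>e\<^sub>p\<close> of the complexified Lie algebra of \<open>K\<close> acts on its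
  \<open>-1\<close> eigenspace with eigenvalues \<open>\<plusminus>\<i>\<close>. The eigenspace for \<open>-\<i>\<close> is the sum of the root spaces
  of the negatives \<open>-(\<plusminus>e\<^sub>i\<^sup>* + e\<^sub>p\<^sup>*)\<close> of the positive noncompact roots; see
  \<open>weight_vector_in_p_minus\<close>, \<open>adj_weight_vector\<close> and \<open>p_minus_weight_decomposition\<close>.\<close>

definition p_complex :: "nat \<Rightarrow> complex mat set" where
  "p_complex p = {X \<in> so_complex p. form_mat p * X * form_mat p = - X}"

definition p_minus :: "nat \<Rightarrow> complex mat set" where
  "p_minus p = {X \<in> p_complex p.
     cartan_basis p p * X - X * cartan_basis p p = (- \<i>) \<cdot>\<^sub>m X}"

text \<open>The action by conjugation; the inverse of an element of the torus is its transpose.\<close>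

definition adj :: "complex mat \<Rightarrow> complex mat \<Rightarrow> complex mat" where
  "adj t X = t * X * transpose_mat t"

definition stabilizer :: "nat \<Rightarrow> complex mat \<Rightarrow> complex mat set" where
  "stabilizer p v = {t \<in> torus p. adj t v = v}"

definition mat_topology :: "nat \<Rightarrow> complex mat topology" where
  "mat_topology n = pullback_topology (carrier_mat n n)
     (\<lambda>A. restrict (\<lambda>ij. A $$ ij) ({..<n} \<times> {..<n}))
     (product_topology (\<lambda>_. euclidean) ({..<n} \<times> {..<n}))"

text \<open>For algebraic groups over \<open>\<complex>\<close> the identity components for the Zariski and for the classical
  topology coincide.\<close>

definition identity_component :: "nat \<Rightarrow> complex mat set \<Rightarrow> complex mat set" where
  "identity_component n H = connected_component_of_set (subtopology (mat_topology n) H) (1\<^sub>m n)"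

definition p_minus_admissible :: "nat \<Rightarrow> int vec \<Rightarrow> bool" where
  "p_minus_admissible p l \<longleftrightarrow>
     (\<exists>v \<in> p_minus p. one_ps p l ` (- {0}) = identity_component (2 * p + 2) (stabilizer p v))"

text \<open>Nonnegativity on the positive compact roots \<open>e\<^sub>i\<^sup>* \<plusminus> e\<^sub>j\<^sup>*\<close>; see \<open>dominant_iff\<close>.\<close>

definition dominant :: "nat \<Rightarrow> int vec \<Rightarrow> bool" where
  "dominant p l \<longleftrightarrow> (\<forall>i j. i < j \<and> j < p \<longrightarrow>
     vec_index l i - vec_index l j \<ge> 0 \<and> vec_index l i + vec_index l j \<ge> 0)"

definition indivisible :: "nat \<Rightarrow> int vec \<Rightarrow> bool" where
  "indivisible p l \<longleftrightarrow> \<not> (\<exists>n > (1 :: int). \<exists>l' \<in> carrier_vec (p + 1). l = n \<cdot>\<^sub>v l')"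

definition lambda_0 :: "nat \<Rightarrow> int vec" where
  "lambda_0 p = vec (p + 1) (\<lambda>k. if k = 0 then 1 else 0)"

definition lambda_pos :: "nat \<Rightarrow> int \<Rightarrow> int vec" where
  "lambda_pos p s = vec (p + 1) (\<lambda>k. if k = p then s else 1)"

definition lambda_neg :: "nat \<Rightarrow> int \<Rightarrow> int vec" where
  "lambda_neg p s = vec (p + 1) (\<lambda>k. if k = p then s else if k = p - 1 then - 1 else 1)"


lemma dominant_iff:
  assumes "p \<ge> 2"
  shows "dominant p l \<longleftrightarrow> (\<forall>i. i + 1 < p \<longrightarrow> vec_index l i \<ge> vec_index l (i + 1)) \<and>
    vec_index l (p - 2) + vec_index l (p - 1) \<ge> 0"
proof (intro iffI conjI allI impI)
  fix i assume "dominant p l" "i + 1 < p"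
  then show "vec_index l i \<ge> vec_index l (i + 1)"
    unfolding dominant_def by (metis diff_ge_0_iff_ge less_add_one)
next
  assume "dominant p l"
  moreover have "p - 2 < p - 1" "p - 1 < p" using assms by auto
  ultimately show "vec_index l (p - 2) + vec_index l (p - 1) \<ge> 0"
    unfolding dominant_def by blast
next
  assume *: "(\<forall>i. i + 1 < p \<longrightarrow> vec_index l i \<ge> vec_index l (i + 1)) \<and>
    vec_index l (p - 2) + vec_index l (p - 1) \<ge> 0"
  have mono: "vec_index l i \<ge> vec_index l j" if "i \<le> j" "j < p" for i j
    using that
  proof (induction j rule: dec_induct)
    case (step j)
    then have "vec_index l j \<ge> vec_index l (Suc j)" "vec_index l i \<ge> vec_index l j"
      using * by auto
    then show ?case by simp
  qed simp
  show "dominant p l"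
    unfolding dominant_def
  proof (intro allI impI)
    fix i j assume ij: "i < j \<and> j < p"
    then have "vec_index l i \<ge> vec_index l (p - 2)" "vec_index l j \<ge> vec_index l (p - 1)"
      "vec_index l i \<ge> vec_index l j"
      by (intro mono; linarith)+
    then show "vec_index l i - vec_index l j \<ge> 0 \<and> vec_index l i + vec_index l j \<ge> 0"
      using * by linarith
  qed
qed

lemma one_ps_in_torus:
  assumes "z \<noteq> 0"
  shows "one_ps p l z \<in> torus p"
proof -
  have "((w + inverse w) / 2)\<^sup>2 + ((w - inverse w) / (2 * \<i>))\<^sup>2 = 1" if "w \<noteq> 0" for w :: complex
    using that by (simp add: power2_eq_square field_simps)
  then show ?thesis
    unfolding one_ps_def torus_def using assms
    by (auto simp: power_int_minus intro!: exI)
qed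

lemma one_ps_character:
  "z \<noteq> 0 \<Longrightarrow> (z powi m + z powi (- m)) / 2 + \<i> * ((z powi m - z powi (- m)) / (2 * \<i>)) = z powi m"
  by (simp add: field_simps)


text \<open>The remaining facts show that \<open>p_minus p\<close> has the asserted weights: it is spanned by
  the \<open>2p\<close> vectors below. For \<open>s = 1\<close> and \<open>s = -1\<close>, \<open>weight_vector p k s\<close> has weight \<open>s e\<^sub>k\<^sup>* - e\<^sub>p\<^sup>*\<close>.\<close>

definition p_minus_coords :: "nat \<Rightarrow> (nat \<Rightarrow> complex) \<Rightarrow> complex mat" where
  "p_minus_coords p x = mat (2 * p + 2) (2 * p + 2) (\<lambda>(i, j).
     if i < 2 * p \<and> j = 2 * p then x i
     else if i < 2 * p \<and> j = 2 * p + 1 then - \<i> * x i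
     else if i = 2 * p \<and> j < 2 * p then x j
     else if i = 2 * p + 1 \<and> j < 2 * p then - \<i> * x j
     else 0)"

definition weight_vector :: "nat \<Rightarrow> nat \<Rightarrow> complex \<Rightarrow> complex mat" where
  "weight_vector p k s = p_minus_coords p
     (\<lambda>i. if i = 2 * k then 1 else if i = 2 * k + 1 then s * \<i> else 0)"


lemma dim_block_diag [simp]:
  "dim_row (block_diag p a b) = 2 * p + 2" "dim_col (block_diag p a b) = 2 * p + 2"
  "block_diag p a b \<in> carrier_mat (2 * p + 2) (2 * p + 2)"
  by (auto simp: block_diag_def)

lemma form_mat_block: "form_mat p = block_diag p (\<lambda>k. if k < p then 1 else - 1) (\<lambda>_. 0)"
  unfolding form_mat_def block_diag_def by (rule eq_matI) auto

lemma transpose_block_diag: "transpose_mat (block_diag p a b) = block_diag p a (\<lambda>k. - b k)"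
  unfolding block_diag_def
  by (rule eq_matI) (auto, presburger+)

lemma block_diag_times:
  assumes "X \<in> carrier_mat (2 * p + 2) m" "i < 2 * p + 2" "j < m"
  shows "(block_diag p a b * X) $$ (i, j) = a (i div 2) * X $$ (i, j) +
    (if even i then b (i div 2) * X $$ (i + 1, j) else - b (i div 2) * X $$ (i - 1, j))"
proof -
  define i' where "i' = (if even i then i + 1 else i - 1)"
  have i': "i' \<noteq> i" "i' < 2 * p + 2" "i' div 2 = i div 2"
    using assms(2) unfolding i'_def by (auto elim: evenE oddE) presburger
  have other: "k div 2 \<noteq> i div 2" if "k \<noteq> i" "k \<noteq> i'" for k
    using that unfolding i'_def by (auto split: if_splits) presburger+
  have "(block_diag p a b * X) $$ (i, j) =
    (\<Sum>k\<in>{0..<2 * p + 2}. block_diag p a b $$ (i, k) * X $$ (k, j))"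
    using assms by (auto simp: scalar_prod_def)
  also have "\<dots> = (\<Sum>k\<in>{i, i'}. block_diag p a b $$ (i, k) * X $$ (k, j))"
    using assms i' other by (intro sum.mono_neutral_right) (auto simp: block_diag_def)
  also have "\<dots> = block_diag p a b $$ (i, i) * X $$ (i, j) + block_diag p a b $$ (i, i') * X $$ (i', j)"
    using i' by simp
  finally show ?thesis
    using assms i' by (auto simp: block_diag_def i'_def)
qed

lemma times_block_diag:
  assumes "X \<in> carrier_mat m (2 * p + 2)" "i < m" "j < 2 * p + 2"
  shows "(X * block_diag p a b) $$ (i, j) = a (j div 2) * X $$ (i, j) +
    (if even j then - b (j div 2) * X $$ (i, j + 1) else b (j div 2) * X $$ (i, j - 1))"
proof -
  have "X * block_diag p a b = transpose_mat (block_diag p a (\<lambda>k. - b k) * transpose_mat X)"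
    using assms by (subst transpose_mult) (auto simp: transpose_block_diag)
  then have "(X * block_diag p a b) $$ (i, j) = (block_diag p a (\<lambda>k. - b k) * transpose_mat X) $$ (j, i)"
    using assms by simp
  also have "\<dots> = a (j div 2) * transpose_mat X $$ (j, i) +
    (if even j then - b (j div 2) * transpose_mat X $$ (j + 1, i)
     else - (- b (j div 2)) * transpose_mat X $$ (j - 1, i))"
    using assms by (subst block_diag_times) auto
  also have "\<dots> = a (j div 2) * X $$ (i, j) +
    (if even j then - b (j div 2) * X $$ (i, j + 1) else b (j div 2) * X $$ (i, j - 1))"
  proof (cases "even j")
    case True
    then have "j + 1 < 2 * p + 2" using assms(3) by presburger
    then show ?thesis using True assms by simp
  next
    case False
    then show ?thesis using assms by simp
  qed
  finally show ?thesis .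
qed

lemma p_minus_coords_carrier [simp]:
  "p_minus_coords p x \<in> carrier_mat (2 * p + 2) (2 * p + 2)"
  "dim_row (p_minus_coords p x) = 2 * p + 2" "dim_col (p_minus_coords p x) = 2 * p + 2"
  by (auto simp: p_minus_coords_def)


lemma mat_eq_iff_entries:
  assumes "A \<in> carrier_mat n m" "B \<in> carrier_mat n m"
  shows "A = B \<longleftrightarrow> (\<forall>i<n. \<forall>j<m. A $$ (i, j) = B $$ (i, j))"
  using assms by (auto intro!: eq_matI)

lemma p_minus_iff:
  assumes X: "X \<in> carrier_mat (2 * p + 2) (2 * p + 2)"
  defines "\<sigma> \<equiv> \<lambda>i. if i < 2 * p then 1 else (- 1 :: complex)"
  shows "X \<in> p_minus p \<longleftrightarrow> (\<forall>i<2 * p + 2. \<forall>j<2 * p + 2.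
     \<sigma> j * X $$ (j, i) + \<sigma> i * X $$ (i, j) = 0 \<and>
     \<sigma> i * \<sigma> j * X $$ (i, j) = - X $$ (i, j) \<and>
     (if i = 2 * p then X $$ (2 * p + 1, j) else if i = 2 * p + 1 then - X $$ (2 * p, j) else 0) -
     (if j = 2 * p then - X $$ (i, 2 * p + 1) else if j = 2 * p + 1 then X $$ (i, 2 * p) else 0) =
     - \<i> * X $$ (i, j))"
proof -
  let ?n = "2 * p + 2"
  let ?J = "form_mat p" and ?E = "cartan_basis p p"
  have J: "?J \<in> carrier_mat ?n ?n" and E: "?E \<in> carrier_mat ?n ?n"
    by (auto simp: form_mat_block cartan_basis_def)
  have \<sigma>: "(if i div 2 < p then 1 else - 1) = \<sigma> i" for i
    unfolding \<sigma>_def by auto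
  have JX: "(?J * Y) $$ (i, j) = \<sigma> i * Y $$ (i, j)"
    and XJ: "(Y * ?J) $$ (i, j) = \<sigma> j * Y $$ (i, j)"
    if "Y \<in> carrier_mat ?n ?n" "i < ?n" "j < ?n" for Y i j
    using block_diag_times[OF that] times_block_diag[OF that]
    by (auto simp: form_mat_block \<sigma>)
  have EX: "(?E * X) $$ (i, j) =
      (if i = 2 * p then X $$ (2 * p + 1, j) else if i = 2 * p + 1 then - X $$ (2 * p, j) else 0)"
    and XE: "(X * ?E) $$ (i, j) =
      (if j = 2 * p then - X $$ (i, 2 * p + 1) else if j = 2 * p + 1 then X $$ (i, 2 * p) else 0)"
    if "i < ?n" "j < ?n" for i j
  proof -
    have "i div 2 = p \<longleftrightarrow> i = 2 * p \<or> i = 2 * p + 1" "j div 2 = p \<longleftrightarrow> j = 2 * p \<or> j = 2 * p + 1"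
      by presburger+
    then show "(?E * X) $$ (i, j) =
      (if i = 2 * p then X $$ (2 * p + 1, j) else if i = 2 * p + 1 then - X $$ (2 * p, j) else 0)"
      "(X * ?E) $$ (i, j) =
      (if j = 2 * p then - X $$ (i, 2 * p + 1) else if j = 2 * p + 1 then X $$ (i, 2 * p) else 0)"
      using block_diag_times[OF X that] times_block_diag[OF X that]
      by (auto simp: cartan_basis_def)
  qed
  have 1: "transpose_mat X * ?J + ?J * X = 0\<^sub>m ?n ?n \<longleftrightarrow>
    (\<forall>i<?n. \<forall>j<?n. \<sigma> j * X $$ (j, i) + \<sigma> i * X $$ (i, j) = 0)"
  proof -
    have "(transpose_mat X * ?J + ?J * X) $$ (i, j) = \<sigma> j * X $$ (j, i) + \<sigma> i * X $$ (i, j)"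
      if "i < ?n" "j < ?n" for i j
    proof -
      have "(transpose_mat X * ?J + ?J * X) $$ (i, j) =
          (transpose_mat X * ?J) $$ (i, j) + (?J * X) $$ (i, j)"
        by (rule index_add_mat) (use that X J in auto)
      also have "\<dots> = \<sigma> j * transpose_mat X $$ (i, j) + \<sigma> i * X $$ (i, j)"
        using that X by (subst XJ, simp_all only: JX transpose_carrier_mat)
      finally show ?thesis using that X by simp
    qed
    then show ?thesis
      using X J by (subst mat_eq_iff_entries[of _ ?n ?n]) auto
  qed
  have 2: "?J * X * ?J = - X \<longleftrightarrow> (\<forall>i<?n. \<forall>j<?n. \<sigma> i * \<sigma> j * X $$ (i, j) = - X $$ (i, j))"
  proof -
    have "(?J * X * ?J) $$ (i, j) = \<sigma> i * \<sigma> j * X $$ (i, j)" if "i < ?n" "j < ?n" for i j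
      by (subst XJ) (use that X J in \<open>auto simp only: JX mult_carrier_mat mult_ac\<close>)
    moreover have "(- X) $$ (i, j) = - X $$ (i, j)" if "i < ?n" "j < ?n" for i j
      using that X by simp
    moreover have "?J * X * ?J \<in> carrier_mat ?n ?n" "- X \<in> carrier_mat ?n ?n"
      using X J by (auto intro: mult_carrier_mat)
    ultimately show ?thesis
      by (subst mat_eq_iff_entries[of _ ?n ?n]) (auto simp only:)
  qed
  have 3: "?E * X - X * ?E = (- \<i>) \<cdot>\<^sub>m X \<longleftrightarrow> (\<forall>i<?n. \<forall>j<?n.
     (if i = 2 * p then X $$ (2 * p + 1, j) else if i = 2 * p + 1 then - X $$ (2 * p, j) else 0) -
     (if j = 2 * p then - X $$ (i, 2 * p + 1) else if j = 2 * p + 1 then X $$ (i, 2 * p) else 0) =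
     - \<i> * X $$ (i, j))"
  proof -
    have "(?E * X - X * ?E) $$ (i, j) = (?E * X) $$ (i, j) - (X * ?E) $$ (i, j)"
      if "i < ?n" "j < ?n" for i j
      by (rule index_minus_mat) (use that X E in auto)
    moreover have "((- \<i>) \<cdot>\<^sub>m X) $$ (i, j) = - \<i> * X $$ (i, j)" if "i < ?n" "j < ?n" for i j
      using that X by simp
    ultimately show ?thesis
      using X E by (subst mat_eq_iff_entries[of _ ?n ?n]) (auto simp only: EX XE mult_carrier_mat minus_carrier_mat smult_carrier_mat)
  qed
  show ?thesis
    unfolding p_minus_def p_complex_def so_complex_def using X 1 2 3 by blast
qed

lemma p_minus_eq: "p_minus p = range (p_minus_coords p)"
proof (intro equalityI subsetI)
  fix X assume "X \<in> range (p_minus_coords p)"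
  then obtain x where x: "X = p_minus_coords p x" by blast
  show "X \<in> p_minus p"
    unfolding x by (subst p_minus_iff) (auto simp: p_minus_coords_def)
next
  fix X assume X: "X \<in> p_minus p"
  then have car: "X \<in> carrier_mat (2 * p + 2) (2 * p + 2)"
    by (auto simp: p_minus_def p_complex_def so_complex_def)
  note iff = p_minus_iff[OF car, THEN iffD1, OF X, rule_format]
  have zero: "X $$ (i, j) = 0" if "i < 2 * p + 2" "j < 2 * p + 2" "i < 2 * p \<longleftrightarrow> j < 2 * p" for i j
    using iff[OF that(1,2)] that(3) by (auto split: if_splits)
  have sym: "X $$ (j, i) = X $$ (i, j)" if "i < 2 * p" "j < 2 * p + 2" "2 * p \<le> j" for i j
    using iff[of i j] that by auto
  have last: "X $$ (i, 2 * p + 1) = - \<i> * X $$ (i, 2 * p)" if "i < 2 * p" for i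
    using iff[of i "2 * p"] that by auto
  have "X = p_minus_coords p (\<lambda>i. X $$ (i, 2 * p))"
  proof (rule mat_eq_iff_entries[OF car p_minus_coords_carrier(1), THEN iffD2], intro allI impI)
    fix i j assume ij: "i < 2 * p + 2" "j < 2 * p + 2"
    consider "i < 2 * p \<longleftrightarrow> j < 2 * p" | "i < 2 * p" "j = 2 * p" | "i < 2 * p" "j = 2 * p + 1"
      | "i = 2 * p" "j < 2 * p" | "i = 2 * p + 1" "j < 2 * p"
      using ij by linarith
    then show "X $$ (i, j) = p_minus_coords p (\<lambda>i. X $$ (i, 2 * p)) $$ (i, j)"
    proof cases
      case 1
      then show ?thesis using zero[OF ij 1] ij by (auto simp: p_minus_coords_def)
    next
      case 2
      then show ?thesis by (simp add: p_minus_coords_def)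
    next
      case 3
      then show ?thesis using last by (simp add: p_minus_coords_def)
    next
      case 4
      then show ?thesis using sym[of j i] by (simp add: p_minus_coords_def)
    next
      case 5
      then show ?thesis using sym[of j i] last[of j] by (simp add: p_minus_coords_def)
    qed
  qed
  then show "X \<in> range (p_minus_coords p)" by blast
qed

lemma weight_vector_in_p_minus: "weight_vector p k s \<in> p_minus p"
  unfolding weight_vector_def p_minus_eq by blast

lemma adj_p_minus_coords:
  "adj (block_diag p a b) (p_minus_coords p x) =
   (a p - \<i> * b p) \<cdot>\<^sub>m p_minus_coords p (\<lambda>i. a (i div 2) * x i +
     (if even i then b (i div 2) * x (i + 1) else - b (i div 2) * x (i - 1)))"
proof (rule eq_matI)
  let ?n = "2 * p + 2"
  let ?R = "(a p - \<i> * b p) \<cdot>\<^sub>m p_minus_coords p (\<lambda>i. a (i div 2) * x i +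
     (if even i then b (i div 2) * x (i + 1) else - b (i div 2) * x (i - 1)))"
  let ?T = "block_diag p a b" and ?X = "p_minus_coords p x"
  fix i j assume "i < dim_row ?R" "j < dim_col ?R"
  then have ij: "i < ?n" "j < ?n" by auto
  let ?y = "\<lambda>i. a (i div 2) * x i +
     (if even i then b (i div 2) * x (i + 1) else - b (i div 2) * x (i - 1))"
  let ?c = "a p - \<i> * b p" and ?Y = "p_minus_coords p ?y"
  have bound: "k + 1 < 2 * p" if "even k" "k < 2 * p" for k
    using that by presburger
  have TX: "(?T * ?X) $$ (i, j') = (if i < 2 * p then ?Y $$ (i, j') else ?c * ?X $$ (i, j'))"
    if j': "j' < ?n" for j'
  proof -
    have *: "(?T * ?X) $$ (i, j') = a (i div 2) * ?X $$ (i, j') +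
      (if even i then b (i div 2) * ?X $$ (i + 1, j') else - b (i div 2) * ?X $$ (i - 1, j'))"
      using ij j' by (intro block_diag_times) auto
    consider "i < 2 * p" "even i" | "i < 2 * p" "odd i" | "i = 2 * p" | "i = 2 * p + 1"
      using ij by linarith
    then show ?thesis
    proof cases
      case 1
      then show ?thesis
        unfolding * using bound[of i] ij j' by (simp add: p_minus_coords_def algebra_simps)
    next
      case 2
      then have "i - 1 < 2 * p" by simp
      with 2 show ?thesis
        unfolding * using ij j' by (simp add: p_minus_coords_def algebra_simps)
    next
      case 3
      then show ?thesis
        unfolding * using ij j' by (simp add: p_minus_coords_def algebra_simps)
    next
      case 4
      then show ?thesis
        unfolding * using ij j' by (simp add: p_minus_coords_def algebra_simps)
    qed
  qed
  have *: "adj ?T ?X $$ (i, j) = a (j div 2) * (?T * ?X) $$ (i, j) +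
      (if even j then b (j div 2) * (?T * ?X) $$ (i, j + 1)
       else - b (j div 2) * (?T * ?X) $$ (i, j - 1))"
    unfolding adj_def transpose_block_diag using ij
    by (subst times_block_diag[of _ ?n]) (auto intro!: mult_carrier_mat)
  have "adj ?T ?X $$ (i, j) = ?c * ?Y $$ (i, j)"
  proof -
    consider "j < 2 * p" "even j" | "j < 2 * p" "odd j" | "j = 2 * p" | "j = 2 * p + 1"
      using ij by linarith
    then show ?thesis
    proof cases
      case 1
      then show ?thesis
        unfolding * using TX[of j] TX[of "j + 1"] bound[of j] ij
        by (simp add: p_minus_coords_def algebra_simps)
    next
      case 2
      then have "j - 1 < 2 * p" by simp
      with 2 show ?thesis
        unfolding * using TX[of j] TX[of "j - 1"] ij
        by (simp add: p_minus_coords_def algebra_simps)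
    next
      case 3
      then show ?thesis
        unfolding * using TX[of j] TX[of "j + 1"] ij
        by (simp add: p_minus_coords_def algebra_simps)
    next
      case 4
      then show ?thesis
        unfolding * using TX[of j] TX[of "j - 1"] ij
        by (simp add: p_minus_coords_def algebra_simps)
    qed
  qed
  also have "\<dots> = ?R $$ (i, j)" using ij by simp
  finally show "adj ?T ?X $$ (i, j) = ?R $$ (i, j)" .
qed (auto simp: adj_def)

lemma adj_weight_vector:
  assumes "\<forall>l\<le>p. (a l)\<^sup>2 + (b l)\<^sup>2 = 1" "k < p" "s = 1 \<or> s = - 1"
  shows "adj (block_diag p a b) (weight_vector p k s) =
    ((a k + s * \<i> * b k) / (a p + \<i> * b p)) \<cdot>\<^sub>m weight_vector p k s"
    "a k - \<i> * b k = 1 / (a k + \<i> * b k)"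
proof -
  have inv: "a l - \<i> * b l = 1 / (a l + \<i> * b l)" if "l \<le> p" for l
  proof -
    have *: "(a l - \<i> * b l) * (a l + \<i> * b l) = 1"
      using assms(1) that by (simp add: algebra_simps power2_eq_square)
    then have "a l + \<i> * b l \<noteq> 0" by auto
    then show ?thesis using * by (simp add: eq_divide_eq)
  qed
  show "a k - \<i> * b k = 1 / (a k + \<i> * b k)" using inv assms(2) by simp
  let ?x = "\<lambda>i. if i = 2 * k then 1 else if i = 2 * k + 1 then s * \<i> else 0"
  have x: "a (i div 2) * ?x i +
      (if even i then b (i div 2) * ?x (i + 1) else - b (i div 2) * ?x (i - 1)) =
      (a k + s * \<i> * b k) * ?x i" for i
  proof -
    consider "i = 2 * k" | "i = 2 * k + 1" | "i div 2 \<noteq> k" by linarith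
    moreover have "odd i \<Longrightarrow> i - 1 \<noteq> 2 * k + 1" by presburger
    ultimately show ?thesis
      using assms(3) by cases (auto simp: algebra_simps)
  qed
  have smult: "p_minus_coords p (\<lambda>i. c * y i) = c \<cdot>\<^sub>m p_minus_coords p y" for c y
    by (rule eq_matI) (auto simp: p_minus_coords_def)
  have "adj (block_diag p a b) (weight_vector p k s) =
      (a p - \<i> * b p) \<cdot>\<^sub>m ((a k + s * \<i> * b k) \<cdot>\<^sub>m weight_vector p k s)"
    unfolding weight_vector_def adj_p_minus_coords x smult ..
  also have "\<dots> = ((a k + s * \<i> * b k) / (a p + \<i> * b p)) \<cdot>\<^sub>m weight_vector p k s"
    unfolding inv[OF order_refl] by (rule eq_matI) auto
  finally show "adj (block_diag p a b) (weight_vector p k s) =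
    ((a k + s * \<i> * b k) / (a p + \<i> * b p)) \<cdot>\<^sub>m weight_vector p k s" .
qed

lemma p_minus_weight_decomposition:
  "X \<in> p_minus p \<longleftrightarrow> (\<exists>c d. X = mat (2 * p + 2) (2 * p + 2) (\<lambda>ij.
     \<Sum>k<p. c k * weight_vector p k 1 $$ ij + d k * weight_vector p k (- 1) $$ ij))"
proof -
  let ?n = "2 * p + 2"
  let ?x = "\<lambda>k s i. if i = 2 * k then 1 else if i = 2 * k + 1 then s * \<i> else 0"
  define y where "y c d i = (\<Sum>k<p. c k * ?x k 1 i + d k * ?x k (- 1) i)"
    for c d :: "nat \<Rightarrow> complex" and i
  have sum_eq: "mat ?n ?n (\<lambda>ij. \<Sum>k<p. c k * weight_vector p k 1 $$ ij +
      d k * weight_vector p k (- 1) $$ ij) = p_minus_coords p (y c d)" for c d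
  proof (rule eq_matI)
    fix i j assume "i < dim_row (p_minus_coords p (y c d))" "j < dim_col (p_minus_coords p (y c d))"
    then have ij: "i < ?n" "j < ?n" by auto
    define m where "m = (if i < 2 * p then i else j)"
    define u where "u = p_minus_coords p (\<lambda>_. 1) $$ (i, j)"
    have u: "p_minus_coords p z $$ (i, j) = u * z m" for z
      using ij by (auto simp: u_def m_def p_minus_coords_def)
    show "mat ?n ?n (\<lambda>ij. \<Sum>k<p. c k * weight_vector p k 1 $$ ij +
        d k * weight_vector p k (- 1) $$ ij) $$ (i, j) = p_minus_coords p (y c d) $$ (i, j)"
      unfolding weight_vector_def index_mat(1)[OF ij] u y_def sum_distrib_left
      by (rule sum.cong) (auto simp: algebra_simps)
  qed auto
  have coords: "\<exists>c d. p_minus_coords p z = p_minus_coords p (y c d)" for z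
  proof -
    define c where "c k = (z (2 * k) - \<i> * z (2 * k + 1)) / 2" for k
    define d where "d k = (z (2 * k) + \<i> * z (2 * k + 1)) / 2" for k
    have "y c d i = z i" if "i < 2 * p" for i
    proof -
      have "y c d i = (\<Sum>k\<in>{i div 2}. c k * ?x k 1 i + d k * ?x k (- 1) i)"
        unfolding y_def using that by (intro sum.mono_neutral_right) auto
      also have "\<dots> = z i"
        by (cases "even i") (auto simp: c_def d_def field_simps elim!: evenE oddE)
      finally show ?thesis .
    qed
    then have "p_minus_coords p z = p_minus_coords p (y c d)"
      by (intro eq_matI) (auto simp: p_minus_coords_def)
    then show ?thesis by blast
  qed
  show ?thesis unfolding p_minus_eq sum_eq using coords by (auto 4 3)
qed

end

theory Submission
  imports Defs "HOL-Analysis.Convex"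
begin

text \<open>In the coordinates \<open>\<zeta>\<^sub>k = e\<^sub>k\<^sup>*(t)\<close> on the torus, the stabilizer of a vector with components
  \<open>c\<^sub>k\<close> of weight \<open>e\<^sub>k\<^sup>* - e\<^sub>p\<^sup>*\<close> and \<open>d\<^sub>k\<close> of weight \<open>-e\<^sub>k\<^sup>* - e\<^sub>p\<^sup>*\<close> is given by \<open>\<zeta>\<^sub>k = \<zeta>\<^sub>p\<close>
  whenever \<open>c\<^sub>k \<noteq> 0\<close> and \<open>\<zeta>\<^sub>k \<zeta>\<^sub>p = 1\<close> whenever \<open>d\<^sub>k \<noteq> 0\<close>. An index with \<open>c\<^sub>k = d\<^sub>k = 0\<close> leaves \<open>\<zeta>\<^sub>k\<close>
  free, so its coordinate subgroup lies in the identity component. If that component is the image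
  of \<open>\<lambda>\<close>, there is therefore no such index when \<open>\<lambda>\<^sub>p \<noteq> 0\<close>, and exactly one when \<open>\<lambda>\<^sub>p = 0\<close>; hence
  \<open>\<lambda>\<close> is a multiple of \<open>(\<plusminus>1, \<dots>, \<plusminus>1; 1)\<close> or of some \<open>e\<^sub>k\<close>.\<close>

section \<open>Coordinates on the torus and on \<open>p_minus\<close>\<close>

definition torus_point :: "nat \<Rightarrow> (nat \<Rightarrow> complex) \<Rightarrow> complex mat" where
  "torus_point p \<zeta> = block_diag p (\<lambda>k. (\<zeta> k + inverse (\<zeta> k)) / 2)
     (\<lambda>k. (\<zeta> k - inverse (\<zeta> k)) / (2 * \<i>))"

text \<open>These are the coordinates of the combination of the \<open>weight_vector p k 1\<close>
  with coefficients \<open>c k\<close> and the \<open>weight_vector p k (- 1)\<close> with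
  coefficients \<open>d k\<close>.\<close>

definition p_minus_point :: "nat \<Rightarrow> (nat \<Rightarrow> complex) \<Rightarrow> (nat \<Rightarrow> complex) \<Rightarrow> complex mat" where
  "p_minus_point p c d = p_minus_coords p (\<lambda>i. if even i then c (i div 2) + d (i div 2)
     else \<i> * (c (i div 2) - d (i div 2)))"

lemma block_diag_entries:
  assumes "k \<le> p"
  shows "block_diag p a b $$ (2 * k, 2 * k) = a k"
    "block_diag p a b $$ (2 * k, 2 * k + 1) = b k"
  using assms by (auto simp: block_diag_def)

lemma block_diag_cong:
  assumes "\<And>k. k \<le> p \<Longrightarrow> a k = a' k" "\<And>k. k \<le> p \<Longrightarrow> b k = b' k"
  shows "block_diag p a b = block_diag p a' b'"
  using assms by (intro eq_matI) (auto simp: block_diag_def)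

lemma torus_point_character:
  assumes "k \<le> p"
  shows "torus_point p \<zeta> $$ (2 * k, 2 * k) + \<i> * torus_point p \<zeta> $$ (2 * k, 2 * k + 1) = \<zeta> k"
  unfolding torus_point_def block_diag_entries[OF assms] by (simp add: field_simps)

lemma torus_point_eq_iff: "torus_point p \<zeta> = torus_point p \<eta> \<longleftrightarrow> (\<forall>k\<le>p. \<zeta> k = \<eta> k)"
proof
  assume "torus_point p \<zeta> = torus_point p \<eta>"
  then show "\<forall>k\<le>p. \<zeta> k = \<eta> k"
    by (metis torus_point_character)
next
  assume "\<forall>k\<le>p. \<zeta> k = \<eta> k"
  then show "torus_point p \<zeta> = torus_point p \<eta>"
    unfolding torus_point_def by (intro block_diag_cong) auto
qed

text \<open>The form \<open>(a k)\<^sup>2 + (b k)\<^sup>2\<close> factors as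
  \<open>(a k + \<i> * b k) * (a k - \<i> * b k)\<close>, so the equation of a block says that the
  first factor is invertible with the second as its inverse.\<close>

lemma torus_eq: "torus p = {torus_point p \<zeta> | \<zeta>. \<forall>k\<le>p. \<zeta> k \<noteq> 0}"
proof (intro equalityI subsetI)
  fix t assume "t \<in> torus p"
  then obtain a b where t: "t = block_diag p a b" and ab: "\<forall>k\<le>p. (a k)\<^sup>2 + (b k)\<^sup>2 = 1"
    unfolding torus_def by blast
  let ?\<zeta> = "\<lambda>k. a k + \<i> * b k"
  have inv: "?\<zeta> k \<noteq> 0 \<and> inverse (?\<zeta> k) = a k - \<i> * b k" if "k \<le> p" for k
  proof -
    have "(a k + \<i> * b k) * (a k - \<i> * b k) = 1"
      using ab that by (simp add: algebra_simps power2_eq_square)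
    then show ?thesis by (auto simp: inverse_unique)
  qed
  then have "t = torus_point p ?\<zeta>"
    unfolding t torus_point_def by (intro block_diag_cong) simp_all
  with inv show "t \<in> {torus_point p \<zeta> | \<zeta>. \<forall>k\<le>p. \<zeta> k \<noteq> 0}" by blast
next
  fix t assume "t \<in> {torus_point p \<zeta> | \<zeta>. \<forall>k\<le>p. \<zeta> k \<noteq> 0}"
  then obtain \<zeta> where t: "t = torus_point p \<zeta>" and \<zeta>: "\<forall>k\<le>p. \<zeta> k \<noteq> 0" by blast
  have "((w + inverse w) / 2)\<^sup>2 + ((w - inverse w) / (2 * \<i>))\<^sup>2 = 1" if "w \<noteq> 0" for w :: complex
    using that by (simp add: power2_eq_square field_simps)
  with \<zeta> show "t \<in> torus p"
    unfolding t torus_point_def torus_def by blast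
qed

lemma one_ps_eq_torus_point:
  "one_ps p l z = torus_point p (\<lambda>k. z powi vec_index l k)"
  unfolding one_ps_def torus_point_def by (simp add: power_int_minus)

lemma p_minus_coords_eq_iff:
  "p_minus_coords p x = p_minus_coords p y \<longleftrightarrow> (\<forall>i<2 * p. x i = y i)"
proof
  have "p_minus_coords p z $$ (i, 2 * p) = z i" if "i < 2 * p" for z i
    using that by (simp add: p_minus_coords_def)
  moreover assume "p_minus_coords p x = p_minus_coords p y"
  ultimately show "\<forall>i<2 * p. x i = y i" by metis
next
  assume "\<forall>i<2 * p. x i = y i"
  then show "p_minus_coords p x = p_minus_coords p y"
    by (intro eq_matI) (auto simp: p_minus_coords_def)
qed

lemma p_minus_point_eq_iff:
  "p_minus_point p c d = p_minus_point p c' d' \<longleftrightarrow> (\<forall>k<p. c k = c' k \<and> d k = d' k)"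
proof
  assume "p_minus_point p c d = p_minus_point p c' d'"
  note * = this[unfolded p_minus_point_def p_minus_coords_eq_iff, rule_format]
  show "\<forall>k<p. c k = c' k \<and> d k = d' k"
  proof (intro allI impI)
    fix k assume "k < p"
    then have "c k + d k = c' k + d' k" "c k - d k = c' k - d' k"
      using *[of "2 * k"] *[of "2 * k + 1"] by auto
    then show "c k = c' k \<and> d k = d' k"
      by (auto simp: complex_eq_iff)
  qed
next
  assume "\<forall>k<p. c k = c' k \<and> d k = d' k"
  then show "p_minus_point p c d = p_minus_point p c' d'"
    unfolding p_minus_point_def p_minus_coords_eq_iff by auto
qed

lemma p_minus_eq_points: "p_minus p = {p_minus_point p c d | c d. True}"
proof -
  \<comment> \<open>The coefficients invert \<open>x (2 * k) = c k + d k\<close> and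
    \<open>x (2 * k + 1) = \<i> * (c k - d k)\<close>.\<close>
  have "p_minus_coords p x = p_minus_point p (\<lambda>k. (x (2 * k) - \<i> * x (2 * k + 1)) / 2)
      (\<lambda>k. (x (2 * k) + \<i> * x (2 * k + 1)) / 2)" for x
    unfolding p_minus_point_def p_minus_coords_eq_iff
    by (auto simp: field_simps elim!: evenE oddE)
  then have "range (p_minus_coords p) \<subseteq> {p_minus_point p c d | c d. True}" by blast
  then show ?thesis
    unfolding p_minus_eq by (auto simp: p_minus_point_def)
qed

text \<open>Passing to weight components diagonalises each rotation block; the common factor
  \<open>inverse (\<zeta> p)\<close> comes from the weight \<open>-e\<^sub>p\<^sup>*\<close> shared
  by all of them.\<close>

lemma adj_torus_point:
  "adj (torus_point p \<zeta>) (p_minus_point p c d) =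
   p_minus_point p (\<lambda>k. inverse (\<zeta> p) * \<zeta> k * c k) (\<lambda>k. inverse (\<zeta> p) * inverse (\<zeta> k) * d k)"
proof -
  have smult: "u \<cdot>\<^sub>m p_minus_coords p y = p_minus_coords p (\<lambda>i. u * y i)" for u y
    by (rule eq_matI) (auto simp: p_minus_coords_def)
  have char: "(\<zeta> p + inverse (\<zeta> p)) / 2 - \<i> * ((\<zeta> p - inverse (\<zeta> p)) / (2 * \<i>)) = inverse (\<zeta> p)"
    by (simp add: field_simps)
  \<comment> \<open>Here \<open>w\<close> stands for \<open>inverse (\<zeta> k)\<close>. Both
    identities are linear in \<open>z\<close> and \<open>w\<close>, so the relation between the two
    does not enter.\<close>
  have even: "u * ((z + w) / 2 * (c + d) + (z - w) / (2 * \<i>) * (\<i> * (c - d))) =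
      u * z * c + u * w * d"
    and odd: "u * ((z + w) / 2 * (\<i> * (c - d)) + - ((z - w) / (2 * \<i>)) * (c + d)) =
      \<i> * (u * z * c - u * w * d)"
    for u z w c d :: complex
    by (simp_all add: field_simps)
  show ?thesis
    unfolding torus_point_def p_minus_point_def adj_p_minus_coords char smult p_minus_coords_eq_iff
  proof (intro allI impI, goal_cases)
    case (1 i)
    show ?case
    proof (cases "even i")
      case True
      then have *: "\<not> even (i + 1)" "(i + 1) div 2 = i div 2" by auto
      show ?thesis by (simp only: True * if_True if_False even)
    next
      case False
      then have *: "even (i - 1)" "(i - 1) div 2 = i div 2" by (auto elim!: oddE)
      show ?thesis by (simp only: False * if_True if_False odd)
    qed
  qed
qed

text \<open>Weight components are scaled separately, so a vector is fixed exactly when every weight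
  with a nonzero component takes the value 1.\<close>

lemma torus_point_in_stabilizer_iff:
  assumes "\<forall>k\<le>p. \<zeta> k \<noteq> 0"
  shows "torus_point p \<zeta> \<in> stabilizer p (p_minus_point p c d) \<longleftrightarrow>
    (\<forall>k<p. (c k \<noteq> 0 \<longrightarrow> \<zeta> k = \<zeta> p) \<and> (d k \<noteq> 0 \<longrightarrow> \<zeta> k = inverse (\<zeta> p)))"
proof -
  have "torus_point p \<zeta> \<in> torus p"
    unfolding torus_eq using assms by blast
  moreover have "inverse (\<zeta> p) * \<zeta> k * c k = c k \<longleftrightarrow> (c k \<noteq> 0 \<longrightarrow> \<zeta> k = \<zeta> p)"
    and "inverse (\<zeta> p) * inverse (\<zeta> k) * d k = d k \<longleftrightarrow> (d k \<noteq> 0 \<longrightarrow> \<zeta> k = inverse (\<zeta> p))"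
    if "k < p" for k
  proof -
    have nz: "\<zeta> k \<noteq> 0" "\<zeta> p \<noteq> 0" using assms that by auto
    then show "inverse (\<zeta> p) * \<zeta> k * c k = c k \<longleftrightarrow> (c k \<noteq> 0 \<longrightarrow> \<zeta> k = \<zeta> p)"
      by (auto simp: field_simps)
    have "\<zeta> k = inverse (\<zeta> p) \<longleftrightarrow> 1 = \<zeta> k * \<zeta> p"
      using nz by (auto simp: field_simps)
    then show "inverse (\<zeta> p) * inverse (\<zeta> k) * d k = d k \<longleftrightarrow> (d k \<noteq> 0 \<longrightarrow> \<zeta> k = inverse (\<zeta> p))"
      using nz by (auto simp: field_simps)
  qed
  ultimately show ?thesis
    unfolding stabilizer_def by (simp add: adj_torus_point p_minus_point_eq_iff)
qed

lemma one_ps_in_stabilizer_iff: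
  assumes "z \<noteq> 0"
  shows "one_ps p l z \<in> stabilizer p (p_minus_point p c d) \<longleftrightarrow>
    (\<forall>k<p. (c k \<noteq> 0 \<longrightarrow> z powi vec_index l k = z powi vec_index l p) \<and>
      (d k \<noteq> 0 \<longrightarrow> z powi vec_index l k = inverse (z powi vec_index l p)))"
  unfolding one_ps_eq_torus_point using assms by (intro torus_point_in_stabilizer_iff) simp

section \<open>Topology of matrices and identity components\<close>

lemma topspace_mat_topology [simp]: "topspace (mat_topology n) = carrier_mat n n"
  unfolding mat_topology_def by (auto simp: topspace_pullback_topology)

lemma continuous_map_mat_entry:
  assumes "i < n" "j < n"
  shows "continuous_map (mat_topology n) euclidean (\<lambda>A. A $$ (i, j))"
proof -
  have "continuous_map (mat_topology n) euclidean
     ((\<lambda>f. f (i, j)) \<circ> (\<lambda>A. restrict (\<lambda>ij. A $$ ij) ({..<n} \<times> {..<n})))"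
    unfolding mat_topology_def
    by (intro continuous_map_pullback continuous_map_product_projection) (use assms in auto)
  then show ?thesis
    by (rule continuous_map_eq) (use assms in auto)
qed

lemma continuous_map_into_mat_topology:
  assumes "\<And>x. x \<in> topspace X \<Longrightarrow> f x \<in> carrier_mat n n"
    and "\<And>i j. i < n \<Longrightarrow> j < n \<Longrightarrow> continuous_map X euclidean (\<lambda>x. f x $$ (i, j))"
  shows "continuous_map X (mat_topology n) f"
  unfolding mat_topology_def
proof (rule continuous_map_pullback')
  show "continuous_map X (product_topology (\<lambda>_. euclidean) ({..<n} \<times> {..<n}))
     ((\<lambda>A. restrict (\<lambda>ij. A $$ ij) ({..<n} \<times> {..<n})) \<circ> f)"
    using assms(2) by (auto simp: continuous_map_componentwise)
  show "topspace X \<subseteq> f -` carrier_mat n n"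
    using assms(1) by auto
qed

lemma one_ps_1: "one_ps p l 1 = 1\<^sub>m (2 * p + 2)"
  unfolding one_ps_def by (intro eq_matI) (auto simp: block_diag_def)

text \<open>The exponential maps the connected plane onto the punctured plane.\<close>

lemma connected_complex_units: "connected (- {0 :: complex})"
proof -
  have "z \<in> range exp" if "z \<noteq> 0" for z :: complex
  proof -
    have "z = exp (of_real (ln (norm z)) + \<i> * of_real (Arg z))"
      using that rcis_cmod_Arg[of z]
      by (simp add: exp_add rcis_def cis_conv_exp exp_of_real)
    then show ?thesis by blast
  qed
  then have "- {0} = range (exp :: complex \<Rightarrow> complex)" by auto
  then show ?thesis
    by (simp add: connected_continuous_image connected_UNIV continuous_on_exp)
qed

text \<open>Every matrix entry is a Laurent polynomial in \<open>z\<close>, hence continuous on the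
  connected punctured plane.\<close>

lemma connectedin_one_ps_image:
  "connectedin (mat_topology (2 * p + 2)) (one_ps p l ` (- {0}))"
proof (rule connectedin_continuous_map_image)
  show "continuous_map (top_of_set (- {0})) (mat_topology (2 * p + 2)) (one_ps p l)"
  proof (rule continuous_map_into_mat_topology)
    fix i j assume ij: "i < 2 * p + 2" "j < 2 * p + 2"
    have eq: "(\<lambda>z. one_ps p l z $$ (i, j)) = (\<lambda>z.
      (if i div 2 \<noteq> j div 2 then 0
       else if i = j then (z powi vec_index l (i div 2) + z powi (- vec_index l (i div 2))) / 2
       else if even i then (z powi vec_index l (i div 2) - z powi (- vec_index l (i div 2))) / (2 * \<i>)
       else - ((z powi vec_index l (i div 2) - z powi (- vec_index l (i div 2))) / (2 * \<i>))))"
      using ij by (intro ext) (simp add: one_ps_def block_diag_def)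
    show "continuous_map (top_of_set (- {0})) euclidean (\<lambda>z. one_ps p l z $$ (i, j))"
      unfolding eq continuous_map_iff_continuous
      by (cases "i div 2 = j div 2"; cases "i = j"; cases "even i")
        (auto intro!: continuous_intros)
  qed (auto simp: one_ps_def)
  show "connectedin (top_of_set (- {0 :: complex})) (- {0})"
    by (auto simp: connectedin_subtopology connected_complex_units)
qed

lemma one_ps_image_subset_identity_component:
  assumes "one_ps p l ` (- {0}) \<subseteq> H"
  shows "one_ps p l ` (- {0}) \<subseteq> identity_component (2 * p + 2) H"
  unfolding identity_component_def
proof (rule connected_component_of_maximal)
  show "connectedin (subtopology (mat_topology (2 * p + 2)) H) (one_ps p l ` (- {0}))"
    using connectedin_one_ps_image assms by (simp add: connectedin_subtopology)
  show "1\<^sub>m (2 * p + 2) \<in> one_ps p l ` (- {0})"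
    by (rule image_eqI[of _ _ 1]) (simp_all add: one_ps_1)
qed

lemma identity_component_subset: "identity_component n H \<subseteq> H"
  unfolding identity_component_def
  using connected_component_of_subset_topspace[of "subtopology (mat_topology n) H"]
  by (auto simp: topspace_subtopology)

text \<open>A connected finite set of complex numbers has at most one point. This tells the identity
  component apart from the other components of a disconnected stabilizer.\<close>

lemma entry_constant_on_identity_component:
  fixes t :: "complex mat"
  assumes "t \<in> identity_component n H" "finite F" "\<And>s. s \<in> H \<Longrightarrow> s $$ (i, j) \<in> F"
    and "i < n" "j < n"
  shows "t $$ (i, j) = 1\<^sub>m n $$ (i, j)"
proof -
  let ?X = "subtopology (mat_topology n) H" and ?C = "identity_component n H"
  have "connectedin ?X ?C"
    unfolding identity_component_def by (rule connectedin_connected_component_of)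
  then have "connectedin euclidean ((\<lambda>A. A $$ (i, j)) ` ?C)"
    by (rule connectedin_continuous_map_image[rotated])
      (intro continuous_map_from_subtopology continuous_map_mat_entry assms)
  then have conn: "connected ((\<lambda>A. A $$ (i, j)) ` ?C)" by simp
  let ?I = "(\<lambda>A. A $$ (i, j)) ` ?C" and ?a = "1\<^sub>m n $$ (i, j)"
  have "finite ?I"
    using assms(2,3) identity_component_subset[of n H] by (auto intro: finite_subset)
  \<comment> \<open>The singleton and the rest of the finite image are disjoint closed sets covering
    it, so one of them misses the image.\<close>
  then have "closed (?I - {?a})" by (simp add: finite_imp_closed)
  then have "{?a} \<inter> ?I = {} \<or> (?I - {?a}) \<inter> ?I = {}"
    by (intro connected_closedD[OF conn]) auto
  \<comment> \<open>The component of a point outside the space is empty; this one contains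
    \<open>t\<close>.\<close>
  moreover have "1\<^sub>m n \<in> ?C"
    using assms(1) unfolding identity_component_def
    by (metis connected_component_of_refl connected_component_of_equiv mem_Collect_eq)
  ultimately show ?thesis using assms(1) by blast
qed

section \<open>Exponents and indivisible vectors\<close>

lemma powi_real_inject_exp:
  fixes x :: real
  assumes "x powi m = x powi n" "x > 0" "x \<noteq> 1"
  shows "m = n"
  using assms power_int_strict_increasing[of m n x] power_int_strict_increasing[of n m x]
    power_int_strict_decreasing[of m n x] power_int_strict_decreasing[of n m x]
  by (cases m n rule: linorder_cases; cases "x > 1") auto

text \<open>As 2 has infinite order, the single point \<open>one_ps p l 2\<close> already determines
  all the exponents.\<close>

lemma powi_two_eq_iff: "(2 :: complex) powi m = 2 powi n \<longleftrightarrow> m = n"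
proof
  assume "(2 :: complex) powi m = 2 powi n"
  then have "norm ((2 :: complex) powi m) = norm ((2 :: complex) powi n)" by simp
  then show "m = n" by (intro powi_real_inject_exp[of 2]) (simp_all add: norm_power_int)
qed simp

lemma norm_eq_1_if_powi_eq_1:
  fixes z :: complex
  assumes "z powi n = 1" "n \<noteq> 0" "z \<noteq> 0"
  shows "norm z = 1"
proof (rule ccontr)
  assume "norm z \<noteq> 1"
  moreover have "norm z powi n = norm z powi 0"
    using assms(1) by (metis norm_power_int norm_one power_int_0_right)
  ultimately show False
    using assms powi_real_inject_exp[of "norm z" n 0] by simp
qed

text \<open>A negative factor becomes positive by moving the sign into the vector.\<close>

lemma indivisible_multiple:
  assumes "indivisible p l" "l = n \<cdot>\<^sub>v l'" "l' \<in> carrier_vec (p + 1)"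
  shows "n = 1 \<or> n = - 1"
proof -
  have "\<not> n > 1" using assms unfolding indivisible_def by blast
  moreover have "\<not> - n > 1"
  proof
    assume "- n > 1"
    moreover have "l = (- n) \<cdot>\<^sub>v (- l')" "- l' \<in> carrier_vec (p + 1)"
      using assms(2,3) by (auto intro!: eq_vecI)
    ultimately show False using assms(1) unfolding indivisible_def by blast
  qed
  moreover have "n \<noteq> 0"
  proof
    assume "n = 0"
    \<comment> \<open>The zero vector is twice itself, hence divisible.\<close>
    then have "l = 2 \<cdot>\<^sub>v (0 \<cdot>\<^sub>v l')" using assms(2,3) by auto
    then show False using assms unfolding indivisible_def
      by (metis smult_carrier_vec one_less_numeral_iff semiring_norm(76))
  qed
  ultimately show ?thesis by linarith
qed

lemma indivisible_if_unit_entry: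
  assumes "vec_index l k = 1" "k \<le> p" "l \<in> carrier_vec (p + 1)"
  shows "indivisible p l"
  unfolding indivisible_def
proof (intro notI, elim exE bexE conjE)
  fix n :: int and l' :: "int vec"
  assume n: "1 < n" and l': "l' \<in> carrier_vec (p + 1)" "l = n \<cdot>\<^sub>v l'"
  then have "n * vec_index l' k = 1" using assms by auto
  then show False using n by (simp add: zmult_eq_1_iff)
qed

section \<open>Necessary conditions for admissibility\<close>

text \<open>On this subgroup only \<open>\<zeta> k\<close> differs from 1, so the only weights
  acting nontrivially are \<open>\<plusminus>e\<^sub>k\<^sup>* - e\<^sub>p\<^sup>*\<close>, and the
  components of the vector in them vanish.\<close>

lemma coordinate_subgroup_in_stabilizer:
  assumes "k < p" "c k = 0" "d k = 0"
  shows "one_ps p (unit_vec (p + 1) k) ` (- {0}) \<subseteq> stabilizer p (p_minus_point p c d)"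
proof (rule image_subsetI)
  fix z :: complex assume "z \<in> - {0}"
  then have "z \<noteq> 0" by simp
  then show "one_ps p (unit_vec (p + 1) k) z \<in> stabilizer p (p_minus_point p c d)"
    unfolding one_ps_in_stabilizer_iff[OF \<open>z \<noteq> 0\<close>] using assms by auto
qed

text \<open>If \<open>\<lambda>(z) = e\<^sub>k(2)\<close> and \<open>\<lambda>\<^sub>j \<noteq> 0\<close>, then \<open>z\<close> to the power \<open>\<lambda>\<^sub>j\<close> is 1, so \<open>z\<close> has modulus 1;
  but \<open>z\<close> to the power \<open>\<lambda>\<^sub>k\<close> is 2.\<close>

lemma zero_entry_if_coordinate_subgroup_in_image:
  assumes "one_ps p (unit_vec (p + 1) k) ` (- {0}) \<subseteq> one_ps p l ` (- {0})"
    and "k \<le> p" "j \<le> p" "j \<noteq> k"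
  shows "vec_index l j = 0"
proof (rule ccontr)
  assume nz: "vec_index l j \<noteq> 0"
  have "one_ps p (unit_vec (p + 1) k) 2 \<in> one_ps p l ` (- {0})"
    using assms(1) by force
  then obtain z where z: "z \<noteq> 0" "one_ps p (unit_vec (p + 1) k) 2 = one_ps p l z" by blast
  then have eq: "2 powi vec_index (unit_vec (p + 1) k) i = z powi vec_index l i" if "i \<le> p" for i
    using that unfolding one_ps_eq_torus_point torus_point_eq_iff by blast
  have "z powi vec_index l j = 1" "z powi vec_index l k = 2"
    using eq[of j] eq[of k] assms by auto
  then have "norm z = 1" "norm (z powi vec_index l k) = 2"
    using norm_eq_1_if_powi_eq_1[OF _ nz z(1)] by simp_all
  then show False by (simp add: norm_power_int)
qed

text \<open>The two outcomes correspond to \<open>vec_index l p\<close> being nonzero or zero. In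
  each, \<open>l\<close> is an integer multiple of a vector with entries in {-1, 0, 1}, and
  indivisibility makes the factor a sign.\<close>

lemma admissible_indivisible_cases:
  assumes l: "l \<in> carrier_vec (p + 1)" and ind: "indivisible p l"
    and adm: "p_minus_admissible p l"
  obtains (signs) "\<forall>k\<le>p. \<bar>vec_index l k\<bar> = 1"
    | (unit) k where "k < p" "\<bar>vec_index l k\<bar> = 1" "\<forall>j\<le>p. j \<noteq> k \<longrightarrow> vec_index l j = 0"
proof -
  from adm obtain c d where cd:
    "one_ps p l ` (- {0}) = identity_component (2 * p + 2) (stabilizer p (p_minus_point p c d))"
    unfolding p_minus_admissible_def p_minus_eq_points by blast
  \<comment> \<open>Evaluating at 2 turns the equations between characters into equations between
    exponents.\<close>
  then have "one_ps p l 2 \<in> stabilizer p (p_minus_point p c d)"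
    using identity_component_subset by fastforce
  then have lk: "c k \<noteq> 0 \<Longrightarrow> vec_index l k = vec_index l p"
      "d k \<noteq> 0 \<Longrightarrow> vec_index l k = - vec_index l p" if "k < p" for k
    using that by (simp_all add: one_ps_in_stabilizer_iff powi_two_eq_iff flip: power_int_minus)
  \<comment> \<open>The coordinate subgroup of a free index \<open>k\<close> is connected, so it
    lies in the identity component, which is the image of \<open>l\<close>.\<close>
  have free: "vec_index l j = 0" if "k < p" "c k = 0" "d k = 0" "j \<le> p" "j \<noteq> k" for j k
    using zero_entry_if_coordinate_subgroup_in_image[of p k l j] coordinate_subgroup_in_stabilizer[of k p c d]
      one_ps_image_subset_identity_component that unfolding cd by auto
  show ?thesis
  proof (cases "vec_index l p = 0")
    case False
    \<comment> \<open>A free index \<open>k\<close> would force \<open>vec_index l p = 0\<close>, so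
      one of \<open>c k\<close>, \<open>d k\<close> is nonzero and fixes the entry up to
      sign.\<close>
    then have ends: "\<bar>vec_index l k\<bar> = \<bar>vec_index l p\<bar>" if "k \<le> p" for k
      using lk[of k] free[of k p] that False by (cases "k = p"; cases "c k = 0"; cases "d k = 0") auto
    have "l = vec_index l p \<cdot>\<^sub>v vec (p + 1) (\<lambda>k. sgn (vec_index l k) * sgn (vec_index l p))"
    proof (rule eq_vecI)
      fix k assume "k < dim_vec (vec_index l p \<cdot>\<^sub>v
        vec (p + 1) (\<lambda>k. sgn (vec_index l k) * sgn (vec_index l p)))"
      then have "k \<le> p" by simp
      then show "vec_index l k = vec_index (vec_index l p \<cdot>\<^sub>v
        vec (p + 1) (\<lambda>k. sgn (vec_index l k) * sgn (vec_index l p))) k"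
        using ends[of k] False by (auto simp: sgn_if abs_if split: if_splits)
    qed (use l in auto)
    from indivisible_multiple[OF ind this] have "\<bar>vec_index l p\<bar> = 1" by auto
    with ends show ?thesis by (intro signs) auto
  next
    case True
    have "\<exists>k\<le>p. vec_index l k \<noteq> 0"
    proof (rule ccontr)
      assume "\<not> ?thesis"
      then have "l = 0 \<cdot>\<^sub>v l" using l by (intro eq_vecI) auto
      from indivisible_multiple[OF ind this l] show False by simp
    qed
    then obtain k where k: "k < p" "vec_index l k \<noteq> 0"
      using True by (metis le_neq_implies_less)
    \<comment> \<open>A nonzero component at \<open>k\<close> would give
      \<open>vec_index l k\<close> the same absolute value as \<open>vec_index l p\<close>, which is
      0. So \<open>k\<close> is free and all other entries vanish.\<close>
    then have "c k = 0" "d k = 0" using lk[of k] True by auto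
    then have rest: "\<forall>j\<le>p. j \<noteq> k \<longrightarrow> vec_index l j = 0" using free k by blast
    then have "l = vec_index l k \<cdot>\<^sub>v unit_vec (p + 1) k"
      using l k by (intro eq_vecI) auto
    from indivisible_multiple[OF ind this] have "\<bar>vec_index l k\<bar> = 1" by auto
    then show ?thesis using k rest by (intro unit)
  qed
qed

section \<open>Vectors realising the listed subgroups\<close>

text \<open>For each \<open>k < p\<close> exactly one of the two components is nonzero, chosen by
  whether the entries at \<open>k\<close> and \<open>p\<close> agree. Each \<open>\<zeta> k\<close>
  is then a function of \<open>\<zeta> p\<close>, and the stabilizer is itself the connected image
  of \<open>l\<close>.\<close>

lemma p_minus_admissible_signs:
  assumes "\<forall>k\<le>p. \<bar>vec_index l k\<bar> = 1"
  shows "p_minus_admissible p l"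
proof -
  define c d :: "nat \<Rightarrow> complex"
    where "c k = (if vec_index l k = vec_index l p then 1 else 0)" and "d k = 1 - c k" for k
  let ?S = "stabilizer p (p_minus_point p c d)"
  have pm: "vec_index l k = 1 \<or> vec_index l k = - 1" if "k \<le> p" for k
    using assms that by (auto simp: abs_if split: if_splits)
  have "one_ps p l z \<in> ?S" if "z \<noteq> 0" for z
    unfolding one_ps_in_stabilizer_iff[OF that]
  proof (intro allI impI)
    fix k assume "k < p"
    then show "(c k \<noteq> 0 \<longrightarrow> z powi vec_index l k = z powi vec_index l p) \<and>
        (d k \<noteq> 0 \<longrightarrow> z powi vec_index l k = inverse (z powi vec_index l p))"
      using pm[of k] pm[of p] by (auto simp: c_def d_def power_int_minus)
  qed
  then have "one_ps p l ` (- {0}) \<subseteq> ?S" by blast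
  moreover have "?S \<subseteq> one_ps p l ` (- {0})"
  proof
    fix t assume t: "t \<in> ?S"
    then obtain \<zeta> where \<zeta>: "t = torus_point p \<zeta>" "\<forall>k\<le>p. \<zeta> k \<noteq> 0"
      unfolding stabilizer_def torus_eq by blast
    \<comment> \<open>The exponent is 1 or -1, hence its own inverse, and
      \<open>z powi vec_index l p\<close> gives back \<open>\<zeta> p\<close>.\<close>
    define z where "z = \<zeta> p powi vec_index l p"
    have "\<zeta> k = z powi vec_index l k" if "k \<le> p" for k
    proof (cases "k = p")
      case True
      then show ?thesis
        using pm[of p] by (auto simp: z_def power_int_minus)
    next
      case False
      then have "\<zeta> k = (if vec_index l k = vec_index l p then \<zeta> p else inverse (\<zeta> p))"
        using t that torus_point_in_stabilizer_iff[OF \<zeta>(2)]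
        unfolding \<zeta>(1) c_def d_def by (auto split: if_splits)
      then show ?thesis
        using pm[OF that] pm[of p] by (auto simp: z_def power_int_minus)
    qed
    then have "t = one_ps p l z"
      unfolding \<zeta> one_ps_eq_torus_point torus_point_eq_iff by blast
    moreover have "z \<noteq> 0" using \<zeta>(2) by (simp add: z_def)
    ultimately show "t \<in> one_ps p l ` (- {0})" by blast
  qed
  ultimately have "one_ps p l ` (- {0}) = identity_component (2 * p + 2) ?S"
    using one_ps_image_subset_identity_component[of p l ?S]
      identity_component_subset[of "2 * p + 2" ?S] by blast
  then show ?thesis
    unfolding p_minus_admissible_def p_minus_eq_points by blast
qed

text \<open>All weight components other than those at \<open>k = 0\<close> are nonzero, so \<open>\<zeta>\<^sub>p\<^sup>2 = 1\<close> on the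
  stabilizer; this needs a second block, and the stabilizer has two components.\<close>

lemma p_minus_admissible_lambda_0:
  assumes "p \<ge> 2"
  shows "p_minus_admissible p (lambda_0 p)"
proof -
  define c :: "nat \<Rightarrow> complex" where "c k = (if k = 0 then 0 else 1)" for k
  let ?S = "stabilizer p (p_minus_point p c c)" and ?l = "lambda_0 p"
  have idx: "vec_index ?l k = (if k = 0 then 1 else 0)" if "k \<le> p" for k
    using that by (simp add: lambda_0_def)
  have "one_ps p ?l z \<in> ?S" if "z \<noteq> 0" for z
    unfolding one_ps_in_stabilizer_iff[OF that] using assms by (auto simp: c_def idx)
  then have "one_ps p ?l ` (- {0}) \<subseteq> ?S" by blast
  then have "one_ps p ?l ` (- {0}) \<subseteq> identity_component (2 * p + 2) ?S"
    by (rule one_ps_image_subset_identity_component)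
  moreover have "identity_component (2 * p + 2) ?S \<subseteq> one_ps p ?l ` (- {0})"
  proof
    fix t assume t: "t \<in> identity_component (2 * p + 2) ?S"
    have coords: "\<exists>\<zeta>. s = torus_point p \<zeta> \<and> (\<forall>k\<le>p. \<zeta> k \<noteq> 0) \<and>
        (\<zeta> p = 1 \<or> \<zeta> p = - 1) \<and> (\<forall>k\<le>p. k \<noteq> 0 \<longrightarrow> \<zeta> k = \<zeta> p)" if s: "s \<in> ?S" for s
    proof -
      obtain \<zeta> where \<zeta>: "s = torus_point p \<zeta>" "\<forall>k\<le>p. \<zeta> k \<noteq> 0"
        using s unfolding stabilizer_def torus_eq by blast
      then have eq: "\<zeta> k = \<zeta> p" "\<zeta> k = inverse (\<zeta> p)" if "k < p" "k \<noteq> 0" for k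
        using s torus_point_in_stabilizer_iff[OF \<zeta>(2)] that by (auto simp: c_def)
      have "\<zeta> p = inverse (\<zeta> p)" using eq[of 1] assms by simp
      then have "(\<zeta> p)\<^sup>2 = 1" using \<zeta>(2) by (simp add: field_simps power2_eq_square)
      then have "\<zeta> p = 1 \<or> \<zeta> p = - 1" by (simp add: power2_eq_1_iff)
      moreover have "\<forall>k\<le>p. k \<noteq> 0 \<longrightarrow> \<zeta> k = \<zeta> p"
        using eq(1) le_neq_implies_less by blast
      ultimately show ?thesis using \<zeta> by blast
    qed
    \<comment> \<open>For these two values the sine entry of the last block vanishes, so its cosine
      entry, the one on the diagonal, is the character itself and tells the two components
      apart.\<close>
    have entry: "torus_point p \<zeta> $$ (2 * p, 2 * p) = \<zeta> p" if "\<zeta> p = 1 \<or> \<zeta> p = - 1" for \<zeta>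
      using that by (auto simp: torus_point_def block_diag_entries)
    have "t \<in> ?S" using t identity_component_subset by blast
    then obtain \<zeta> where \<zeta>: "t = torus_point p \<zeta>" "\<forall>k\<le>p. \<zeta> k \<noteq> 0"
        "\<zeta> p = 1 \<or> \<zeta> p = - 1" "\<forall>k\<le>p. k \<noteq> 0 \<longrightarrow> \<zeta> k = \<zeta> p"
      using coords by blast
    have "t $$ (2 * p, 2 * p) = 1\<^sub>m (2 * p + 2) $$ (2 * p, 2 * p)"
    proof (rule entry_constant_on_identity_component[OF t])
      show "s $$ (2 * p, 2 * p) \<in> {1, - 1}" if "s \<in> ?S" for s
        using coords[OF that] entry by force
    qed auto
    then have "\<zeta> p = 1" using \<zeta>(1) entry[of \<zeta>] \<zeta>(3) by simp
    then have "t = one_ps p ?l (\<zeta> 0)"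
      unfolding \<zeta>(1) one_ps_eq_torus_point torus_point_eq_iff using \<zeta>(4) by (simp add: idx)
    then show "t \<in> one_ps p ?l ` (- {0})" using \<zeta>(2) by blast
  qed
  ultimately show ?thesis
    unfolding p_minus_admissible_def p_minus_eq_points by blast
qed

section \<open>Dominance and the resulting list\<close>

theorem mainTheorem17:
  fixes p :: nat
  assumes "p \<ge> 2"
  shows "{l \<in> carrier_vec (p + 1). dominant p l \<and> indivisible p l \<and> p_minus_admissible p l} =
    {lambda_0 p, lambda_pos p 1, lambda_pos p (- 1), lambda_neg p 1, lambda_neg p (- 1)}"
    (is "?A = ?B")
proof (intro equalityI subsetI)
  fix l assume "l \<in> ?A"
  then have l: "l \<in> carrier_vec (p + 1)" and dom: "dominant p l" and ind: "indivisible p l"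
    and adm: "p_minus_admissible p l" by auto
  have dom0: "vec_index l 0 \<ge> \<bar>vec_index l 1\<bar>"
    and domk: "\<And>k. 0 < k \<Longrightarrow> k < p \<Longrightarrow> vec_index l 0 \<ge> \<bar>vec_index l k\<bar>"
    using dom assms unfolding dominant_def by force+
  from l ind adm show "l \<in> ?B"
  proof (cases rule: admissible_indivisible_cases)
    case signs
    then have pm: "vec_index l k = 1 \<or> vec_index l k = - 1" if "k \<le> p" for k
      using that by (auto simp: abs_if split: if_splits)
    \<comment> \<open>Dominance bounds this entry below by the absolute value of the entry at
      \<open>p - 1\<close>, which is 1; only the entries at \<open>p - 1\<close> and
      \<open>p\<close> keep a free sign.\<close>
    have one: "vec_index l k = 1" if "k + 1 < p" for k
    proof -
      have "vec_index l k - vec_index l (p - 1) \<ge> 0 \<and> vec_index l k + vec_index l (p - 1) \<ge> 0"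
        using dom that unfolding dominant_def by simp
      then show ?thesis using pm[of k] pm[of "p - 1"] that by auto
    qed
    have "l = (if vec_index l (p - 1) = 1 then lambda_pos p (vec_index l p)
      else lambda_neg p (vec_index l p))"
    proof (rule eq_vecI)
      fix k assume "k < dim_vec (if vec_index l (p - 1) = 1 then lambda_pos p (vec_index l p)
        else lambda_neg p (vec_index l p))"
      then have "k \<le> p" by (auto simp: lambda_pos_def lambda_neg_def split: if_splits)
      then consider "k + 1 < p" | "k = p - 1" "k < p" | "k = p" by linarith
      then show "vec_index l k = vec_index (if vec_index l (p - 1) = 1
        then lambda_pos p (vec_index l p) else lambda_neg p (vec_index l p)) k"
        using one[of k] pm[of "p - 1"] assms
        by cases (auto simp: lambda_pos_def lambda_neg_def)
    qed (use l in \<open>auto simp: lambda_pos_def lambda_neg_def\<close>)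
    then show ?thesis using pm[of p] by (auto split: if_splits)
  next
    case (unit k)
    \<comment> \<open>Otherwise the entry at 0 would be 0 and yet at least 1 by
      \<open>domk\<close>.\<close>
    have "k = 0"
      using unit domk[of k] by (cases "k = 0") auto
    \<comment> \<open>Dominance against the entry at 1, an index below \<open>p\<close>, excludes
      the value -1.\<close>
    moreover have "vec_index l 0 = 1"
      using unit dom0 \<open>k = 0\<close> by auto
    ultimately have "l = lambda_0 p"
      using l unit by (intro eq_vecI) (auto simp: lambda_0_def)
    then show ?thesis by simp
  qed
next
  fix l assume "l \<in> ?B"
  then consider "l = lambda_0 p" | s where "l = lambda_pos p s" "\<bar>s\<bar> = 1"
    | s where "l = lambda_neg p s" "\<bar>s\<bar> = 1"
    by auto
  then show "l \<in> ?A"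
  proof cases
    case 1
    have "indivisible p (lambda_0 p)"
      by (rule indivisible_if_unit_entry[of _ 0]) (auto simp: lambda_0_def)
    with 1 show ?thesis
      using p_minus_admissible_lambda_0[OF assms] by (auto simp: dominant_def lambda_0_def)
  next
    case 2
    have "indivisible p (lambda_pos p s)"
      by (rule indivisible_if_unit_entry[of _ 0]) (use assms in \<open>auto simp: lambda_pos_def\<close>)
    moreover have "p_minus_admissible p (lambda_pos p s)"
      by (rule p_minus_admissible_signs) (use 2 in \<open>auto simp: lambda_pos_def\<close>)
    ultimately show ?thesis
      using 2 by (auto simp: dominant_def lambda_pos_def)
  next
    case 3
    have "indivisible p (lambda_neg p s)"
      by (rule indivisible_if_unit_entry[of _ 0]) (use assms in \<open>auto simp: lambda_neg_def\<close>)
    moreover have "p_minus_admissible p (lambda_neg p s)"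
      by (rule p_minus_admissible_signs) (use 3 in \<open>auto simp: lambda_neg_def\<close>)
    ultimately show ?thesis
      using 3 by (auto simp: dominant_def lambda_neg_def)
  qed
qed

end
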